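(* Let $\mathcal{L}$ be any of $\lambda\mathbf{J}^{\mathbf{ms}}$, $\lambda\mathbf{J}^{\mathbf m}$, $\lambda\mathbf{J}$, with the CGPS translation $\overline{(\cdot)}$ into the $\lambda$-calculus given in the context. If $t\rightarrow u$ in $\mathcal{L}$, then $\overline{t}\rightarrow^+_\beta\overline{u}$ in the $\lambda$-calculus.
   Context: Reductions are closed under all constructors, substitution capture-avoiding, a value $V$ is a variable or a $\lambda$-abstraction. $\lambda\mathbf{J}$: terms $x\mid\lambda x.t\mid t(u,x.v)$; with $R,S$ pairs $(u,x.v)$ and $tRS=(tR)S$: $(u,x.V)@S=(u,x.VS)$, $(u,x.tR')@S=(u,x.t(R'@S))$; rules $(\lambda x.t)(u,y.v)\rightarrow[[u/x]t/y]v$, $tRS\rightarrow t(R@S)$. $\lambda\mathbf{J}^{\mathbf m}$: terms $x\mid\lambda x.t\mid t(u,l)$, co-terms $l::=u::l\mid(x)v$; with $R,S$ pairs $(u,l)$: $(u::l)@S=u::(l@S)$, $((x)V)@S=(x)(VS)$, $((x)t(u,l))@S=(x)t(u,l@S)$, $(u,l)@S=(u,l@S)$; rules $(\lambda x.t)(u,(y)v)\rightarrow[[u/x]t/y]v$, $(\lambda x.t)(u,v::l)\rightarrow([u/x]t)(v,l)$, $tRS\rightarrow t(R@S)$, $(x)x(u,l)\rightarrow u::l$ if $x\notin u,l$. $\lambda\mathbf{J}^{\mathbf{ms}}$: terms $x\mid\lambda x.t\mid t\,l$, co-terms $u::l\mid(x)v$; $(u::l)@l'=u::(l@l')$, $((x)V)@l'=(x)(V\,l')$,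 $((x)t\,l)@l'=(x)t(l@l')$; rules $(\lambda x.t)(u::l)\rightarrow u((x)t\,l)$, $t(x)v\rightarrow[t/x]v$, $(t\,l)(u::l')\rightarrow t(l@(u::l'))$, $(x)x\,l\rightarrow l$ if $x\notin l$. Translation: fix a closed $\lambda$-term $\mathsf{s}$ with $\mathsf{s}G\rightarrow_\beta^+G$ for all $G$ (e.g. $\lambda z.z$), $G^+:=\mathsf{s}G$, $[t;u]:=(\lambda y.t)u$ with $y\notin t$; $w,m$ fresh; in every system $\overline{t}=\lambda gk.(t:g,k)$ with $g,k$ fresh, $(x:G,K)=x\,G^+K$ and $(\lambda x.t:G,K)=[K(\lambda wx.w\,\overline{t});G]$. For $\lambda\mathbf{J}^{\mathbf{ms}}$ additionally: $(u::l:G,K)=\lambda w.wG(\lambda m.m\,(l:G,K)\,\overline{u})$; $(t\,l:G,K)=(t\,l;G^+,K)$; $((x)V:G,K)=\lambda x.(V:G,K)$; $((x)t\,l:G,K)=\lambda x.(t\,l;G,K)$; $(t(x)v;G,K)=((x)v:G,K)\,\overline{t}$; $(t(u::l);G,K)=(t:G,\lambda m.m\,(l:G,K)\,\overline{u})$. For $\lambda\mathbf{J}^{\mathbf m}$ additionally: $(u::l:G,K)$ and $((x)V:G,K)$ as for $\lambda\mathbf{J}^{\mathbf{ms}}$; $(t(u,l):G,K)=(t:G^+,\lambda m.m\,(l:G^+,K)\,\overline{u})$; $((x)t(u,l):G,K)=\lambda x.(t:G,\lambda m.m\,(l:G,K)\,\overline{u})$. For $\lambda\mathbf{J}$ additionally: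 $(t(u,x.V):G,K)=(t:G^+,\lambda m.m\,(\lambda x.(V:G^+,K))\,\overline{u})$ for $V$ a value, and $(t(u,x.v):G,K)=(t:G^+,\lambda m.m\,(\lambda x.(v:G,K))\,\overline{u})$ for $v$ an application. *)

theory Defs
  imports Main
begin

text \<open>
  Terms are taken up to renaming of bound variables and are represented with de Bruijn indices
  in all four calculi. A renaming or substitution acts on all free indices simultaneously;
  capture-avoiding substitution \<open>[u/x]t\<close>, where \<open>x\<close> is bound by the binder just removed (index 0),
  is \<open>inst u t\<close> (and its analogues): index 0 becomes \<open>u\<close> and index \<open>n + 1\<close> becomes \<open>n\<close>.
  Using an expression in the scope of an additional fresh variable is \<open>lift\<close>.
\<close>

definition up_ren :: "(nat \<Rightarrow> nat) \<Rightarrow> nat \<Rightarrow> nat" where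
  "up_ren \<rho> = case_nat 0 (\<lambda>n. Suc (\<rho> n))"


section \<open>The lambda-calculus\<close>

datatype lam = Var nat | Lam lam | App lam lam

primrec ren :: "(nat \<Rightarrow> nat) \<Rightarrow> lam \<Rightarrow> lam" where
  "ren \<rho> (Var n) = Var (\<rho> n)"
| "ren \<rho> (Lam t) = Lam (ren (up_ren \<rho>) t)"
| "ren \<rho> (App t u) = App (ren \<rho> t) (ren \<rho> u)"

abbreviation lift :: "lam \<Rightarrow> lam" where "lift \<equiv> ren Suc"

primrec subst :: "(nat \<Rightarrow> lam) \<Rightarrow> lam \<Rightarrow> lam" where
  "subst \<sigma> (Var n) = \<sigma> n"
| "subst \<sigma> (Lam t) = Lam (subst (case_nat (Var 0) (\<lambda>n. lift (\<sigma> n))) t)"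
| "subst \<sigma> (App t u) = App (subst \<sigma> t) (subst \<sigma> u)"

definition inst :: "lam \<Rightarrow> lam \<Rightarrow> lam" where
  "inst u t = subst (case_nat u Var) t"

primrec fv :: "lam \<Rightarrow> nat set" where
  "fv (Var n) = {n}"
| "fv (Lam t) = {n. Suc n \<in> fv t}"
| "fv (App t u) = fv t \<union> fv u"

definition closed :: "lam \<Rightarrow> bool" where
  "closed t \<longleftrightarrow> fv t = {}"

inductive beta :: "lam \<Rightarrow> lam \<Rightarrow> bool" where
  beta: "beta (App (Lam t) u) (inst u t)"
| Lam: "beta t t' \<Longrightarrow> beta (Lam t) (Lam t')"
| AppL: "beta t t' \<Longrightarrow> beta (App t u) (App t' u)"
| AppR: "beta u u' \<Longrightarrow> beta (App t u) (App t u')"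

text \<open>\<open>brk t u\<close> is \<open>[t; u] = (\<lambda>y. t) u\<close> with \<open>y\<close> fresh, and
  \<open>mpair L U\<close> is \<open>\<lambda>m. m L U\<close> with \<open>m\<close> fresh (also used for \<open>\<lambda>w. w G (\<dots>)\<close>).\<close>

definition brk :: "lam \<Rightarrow> lam \<Rightarrow> lam" where
  "brk t u = App (Lam (lift t)) u"

definition mpair :: "lam \<Rightarrow> lam \<Rightarrow> lam" where
  "mpair L U = Lam (App (App (Var 0) (lift L)) (lift U))"

text \<open>For a term \<open>b\<close> with index 0 standing for \<open>x\<close>,
  \<open>wabs b\<close> is \<open>\<lambda>w x. w b\<close> with \<open>w\<close> fresh.\<close>

definition wabs :: "lam \<Rightarrow> lam" where
  "wabs b = Lam (Lam (App (Var 1) (ren (up_ren Suc) b)))"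


section \<open>The calculus \<open>\<lambda>J\<close>\<close>

text \<open>\<open>JApp t u v\<close> is \<open>t(u, x.v)\<close>; it binds index 0 in \<open>v\<close>.\<close>

datatype jtm = JVar nat | JLam jtm | JApp jtm jtm jtm

primrec jren :: "(nat \<Rightarrow> nat) \<Rightarrow> jtm \<Rightarrow> jtm" where
  "jren \<rho> (JVar n) = JVar (\<rho> n)"
| "jren \<rho> (JLam t) = JLam (jren (up_ren \<rho>) t)"
| "jren \<rho> (JApp t u v) = JApp (jren \<rho> t) (jren \<rho> u) (jren (up_ren \<rho>) v)"

abbreviation jlift :: "jtm \<Rightarrow> jtm" where "jlift \<equiv> jren Suc"

primrec jsubst :: "(nat \<Rightarrow> jtm) \<Rightarrow> jtm \<Rightarrow> jtm" where
  "jsubst \<sigma> (JVar n) = \<sigma> n"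
| "jsubst \<sigma> (JLam t) = JLam (jsubst (case_nat (JVar 0) (\<lambda>n. jlift (\<sigma> n))) t)"
| "jsubst \<sigma> (JApp t u v) =
     JApp (jsubst \<sigma> t) (jsubst \<sigma> u) (jsubst (case_nat (JVar 0) (\<lambda>n. jlift (\<sigma> n))) v)"

definition jinst :: "jtm \<Rightarrow> jtm \<Rightarrow> jtm" where
  "jinst u t = jsubst (case_nat u JVar) t"

fun jvalue :: "jtm \<Rightarrow> bool" where
  "jvalue (JVar n) = True"
| "jvalue (JLam t) = True"
| "jvalue (JApp t u v) = False"

text \<open>The pairs \<open>R = (u, x.v)\<close> are HOL pairs \<open>(u, v)\<close>, with index 0 bound in \<open>v\<close>.\<close>

fun japp :: "jtm \<Rightarrow> jtm \<times> jtm \<Rightarrow> jtm" where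
  "japp t (u, v) = JApp t u v"

fun jargs_lift :: "jtm \<times> jtm \<Rightarrow> jtm \<times> jtm" where
  "jargs_lift (u, v) = (jlift u, jren (up_ren Suc) v)"

fun jappend :: "jtm \<times> jtm \<Rightarrow> jtm \<times> jtm \<Rightarrow> jtm \<times> jtm" where
  "jappend (u, JApp t u' v) S = (u, japp t (jappend (u', v) (jargs_lift S)))"
| "jappend (u, V) S = (u, japp V (jargs_lift S))"

inductive jred :: "jtm \<Rightarrow> jtm \<Rightarrow> bool" where
  beta: "jred (JApp (JLam t) u v) (jinst (jinst u t) v)"
| pi: "jred (japp (japp t R) S) (japp t (jappend R S))"
| Lam: "jred t t' \<Longrightarrow> jred (JLam t) (JLam t')"
| App1: "jred t t' \<Longrightarrow> jred (JApp t u v) (JApp t' u v)"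
| App2: "jred u u' \<Longrightarrow> jred (JApp t u v) (JApp t u' v)"
| App3: "jred v v' \<Longrightarrow> jred (JApp t u v) (JApp t u v')"

lemma size_jren [simp]: "size (jren \<rho> t) = size t"
  by (induction t arbitrary: \<rho>) auto

text \<open>
  \<open>jbar s t\<close> is the translation of \<open>t\<close> and \<open>jcol s t G K\<close> is \<open>(t : G, K)\<close>. The free indices of
  \<open>t\<close>, \<open>G\<close> and \<open>K\<close> refer to one common list of variables, so \<open>t\<close> is lifted past \<open>g\<close> and \<open>k\<close>
  in the translation. As \<open>s\<close> is meant to be closed, it is never lifted.
\<close>

function jbar :: "lam \<Rightarrow> jtm \<Rightarrow> lam" and jcol :: "lam \<Rightarrow> jtm \<Rightarrow> lam \<Rightarrow> lam \<Rightarrow> lam" where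
  "jbar s t = Lam (Lam (jcol s (jlift (jlift t)) (Var 1) (Var 0)))"
| "jcol s (JVar x) G K = App (App (Var x) (App s G)) K"
| "jcol s (JLam t) G K = brk (App K (wabs (jbar s t))) G"
| "jcol s (JApp t u v) G K =
     jcol s t (App s G)
       (mpair (Lam (jcol s v (lift (if jvalue v then App s G else G)) (lift K))) (jbar s u))"
  by pat_completeness auto
termination
  by (relation "measure (\<lambda>p. case p of Inl (s, t) \<Rightarrow> 2 * size t + 1
                                     | Inr (s, t, G, K) \<Rightarrow> 2 * size t)") auto


section \<open>The calculus \<open>\<lambda>J\<^sup>m\<close>\<close>

text \<open>\<open>MApp t u l\<close> is \<open>t(u, l)\<close>, \<open>MCons u l\<close> is \<open>u :: l\<close>, and \<open>MAbs v\<close> is \<open>(x)v\<close>, which binds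
  index 0 in \<open>v\<close>.\<close>

datatype mtm = MVar nat | MLam mtm | MApp mtm mtm mco
     and mco = MCons mtm mco | MAbs mtm

primrec mren :: "(nat \<Rightarrow> nat) \<Rightarrow> mtm \<Rightarrow> mtm"
    and mcren :: "(nat \<Rightarrow> nat) \<Rightarrow> mco \<Rightarrow> mco" where
  "mren \<rho> (MVar n) = MVar (\<rho> n)"
| "mren \<rho> (MLam t) = MLam (mren (up_ren \<rho>) t)"
| "mren \<rho> (MApp t u l) = MApp (mren \<rho> t) (mren \<rho> u) (mcren \<rho> l)"
| "mcren \<rho> (MCons u l) = MCons (mren \<rho> u) (mcren \<rho> l)"
| "mcren \<rho> (MAbs v) = MAbs (mren (up_ren \<rho>) v)"

abbreviation mlift :: "mtm \<Rightarrow> mtm" where "mlift \<equiv> mren Suc"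
abbreviation mclift :: "mco \<Rightarrow> mco" where "mclift \<equiv> mcren Suc"

primrec msubst :: "(nat \<Rightarrow> mtm) \<Rightarrow> mtm \<Rightarrow> mtm"
    and mcsubst :: "(nat \<Rightarrow> mtm) \<Rightarrow> mco \<Rightarrow> mco" where
  "msubst \<sigma> (MVar n) = \<sigma> n"
| "msubst \<sigma> (MLam t) = MLam (msubst (case_nat (MVar 0) (\<lambda>n. mlift (\<sigma> n))) t)"
| "msubst \<sigma> (MApp t u l) = MApp (msubst \<sigma> t) (msubst \<sigma> u) (mcsubst \<sigma> l)"
| "mcsubst \<sigma> (MCons u l) = MCons (msubst \<sigma> u) (mcsubst \<sigma> l)"
| "mcsubst \<sigma> (MAbs v) = MAbs (msubst (case_nat (MVar 0) (\<lambda>n. mlift (\<sigma> n))) v)"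

definition minst :: "mtm \<Rightarrow> mtm \<Rightarrow> mtm" where
  "minst u t = msubst (case_nat u MVar) t"

text \<open>\<open>mcappend l S\<close> is \<open>l @ S\<close> and \<open>mappend R S\<close> is \<open>R @ S\<close>, for \<open>R\<close>, \<open>S\<close> pairs \<open>(u, l)\<close>.\<close>

fun mapp :: "mtm \<Rightarrow> mtm \<times> mco \<Rightarrow> mtm" where
  "mapp t (u, l) = MApp t u l"

fun margs_lift :: "mtm \<times> mco \<Rightarrow> mtm \<times> mco" where
  "margs_lift (u, l) = (mlift u, mclift l)"

fun mcappend :: "mco \<Rightarrow> mtm \<times> mco \<Rightarrow> mco" where
  "mcappend (MCons u l) S = MCons u (mcappend l S)"
| "mcappend (MAbs (MApp t u l)) S = MAbs (MApp t u (mcappend l (margs_lift S)))"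
| "mcappend (MAbs V) S = MAbs (mapp V (margs_lift S))"

fun mappend :: "mtm \<times> mco \<Rightarrow> mtm \<times> mco \<Rightarrow> mtm \<times> mco" where
  "mappend (u, l) S = (u, mcappend l S)"

text \<open>In rule \<open>mu\<close> the side condition \<open>x \<notin> u, l\<close> says that \<open>u\<close> and \<open>l\<close> are lifted.\<close>

inductive mred :: "mtm \<Rightarrow> mtm \<Rightarrow> bool" and mcred :: "mco \<Rightarrow> mco \<Rightarrow> bool" where
  beta1: "mred (MApp (MLam t) u (MAbs v)) (minst (minst u t) v)"
| beta2: "mred (MApp (MLam t) u (MCons v l)) (MApp (minst u t) v l)"
| pi: "mred (mapp (mapp t R) S) (mapp t (mappend R S))"
| mu: "mcred (MAbs (MApp (MVar 0) (mlift u) (mclift l))) (MCons u l)"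
| Lam: "mred t t' \<Longrightarrow> mred (MLam t) (MLam t')"
| App1: "mred t t' \<Longrightarrow> mred (MApp t u l) (MApp t' u l)"
| App2: "mred u u' \<Longrightarrow> mred (MApp t u l) (MApp t u' l)"
| App3: "mcred l l' \<Longrightarrow> mred (MApp t u l) (MApp t u l')"
| Cons1: "mred u u' \<Longrightarrow> mcred (MCons u l) (MCons u' l)"
| Cons2: "mcred l l' \<Longrightarrow> mcred (MCons u l) (MCons u l')"
| Abs: "mred v v' \<Longrightarrow> mcred (MAbs v) (MAbs v')"

lemma size_mren [simp]: "size (mren \<rho> t) = size t"
  and size_mcren [simp]: "size (mcren \<rho> l) = size l"
  by (induction t and l arbitrary: \<rho> and \<rho>) auto

text \<open>\<open>mcol s t G K\<close> is \<open>(t : G, K)\<close> for terms and \<open>mccol s l G K\<close> is \<open>(l : G, K)\<close> for co-terms.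
  In the last equation \<open>V\<close> ranges over the values only, since the equations are sequential.\<close>

function (sequential)
      mbar :: "lam \<Rightarrow> mtm \<Rightarrow> lam"
  and mcol :: "lam \<Rightarrow> mtm \<Rightarrow> lam \<Rightarrow> lam \<Rightarrow> lam"
  and mccol :: "lam \<Rightarrow> mco \<Rightarrow> lam \<Rightarrow> lam \<Rightarrow> lam" where
  "mbar s t = Lam (Lam (mcol s (mlift (mlift t)) (Var 1) (Var 0)))"
| "mcol s (MVar x) G K = App (App (Var x) (App s G)) K"
| "mcol s (MLam t) G K = brk (App K (wabs (mbar s t))) G"
| "mcol s (MApp t u l) G K =
     mcol s t (App s G) (mpair (mccol s l (App s G) K) (mbar s u))"
| "mccol s (MCons u l) G K = mpair G (mpair (mccol s l G K) (mbar s u))"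
| "mccol s (MAbs (MApp t u l)) G K =
     Lam (mcol s t (lift G) (mpair (mccol s l (lift G) (lift K)) (mbar s u)))"
| "mccol s (MAbs V) G K = Lam (mcol s V (lift G) (lift K))"
  by pat_completeness auto
termination
  by (relation "measure (\<lambda>p. case p of Inl (s, t) \<Rightarrow> 2 * size t + 1
                   | Inr (Inl (s, t, G, K)) \<Rightarrow> 2 * size t
                   | Inr (Inr (s, l, G, K)) \<Rightarrow> 2 * size l)") auto


section \<open>The calculus \<open>\<lambda>J\<^sup>m\<^sup>s\<close>\<close>

text \<open>\<open>SApp t l\<close> is \<open>t l\<close>, \<open>SCons u l\<close> is \<open>u :: l\<close>, and \<open>SAbs v\<close> is \<open>(x)v\<close>, which binds index 0
  in \<open>v\<close>.\<close>

datatype stm = SVar nat | SLam stm | SApp stm sco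
     and sco = SCons stm sco | SAbs stm

primrec sren :: "(nat \<Rightarrow> nat) \<Rightarrow> stm \<Rightarrow> stm"
    and scren :: "(nat \<Rightarrow> nat) \<Rightarrow> sco \<Rightarrow> sco" where
  "sren \<rho> (SVar n) = SVar (\<rho> n)"
| "sren \<rho> (SLam t) = SLam (sren (up_ren \<rho>) t)"
| "sren \<rho> (SApp t l) = SApp (sren \<rho> t) (scren \<rho> l)"
| "scren \<rho> (SCons u l) = SCons (sren \<rho> u) (scren \<rho> l)"
| "scren \<rho> (SAbs v) = SAbs (sren (up_ren \<rho>) v)"

abbreviation slift :: "stm \<Rightarrow> stm" where "slift \<equiv> sren Suc"
abbreviation sclift :: "sco \<Rightarrow> sco" where "sclift \<equiv> scren Suc"

primrec ssubst :: "(nat \<Rightarrow> stm) \<Rightarrow> stm \<Rightarrow> stm"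
    and scsubst :: "(nat \<Rightarrow> stm) \<Rightarrow> sco \<Rightarrow> sco" where
  "ssubst \<sigma> (SVar n) = \<sigma> n"
| "ssubst \<sigma> (SLam t) = SLam (ssubst (case_nat (SVar 0) (\<lambda>n. slift (\<sigma> n))) t)"
| "ssubst \<sigma> (SApp t l) = SApp (ssubst \<sigma> t) (scsubst \<sigma> l)"
| "scsubst \<sigma> (SCons u l) = SCons (ssubst \<sigma> u) (scsubst \<sigma> l)"
| "scsubst \<sigma> (SAbs v) = SAbs (ssubst (case_nat (SVar 0) (\<lambda>n. slift (\<sigma> n))) v)"

definition sinst :: "stm \<Rightarrow> stm \<Rightarrow> stm" where
  "sinst u t = ssubst (case_nat u SVar) t"

fun sappend :: "sco \<Rightarrow> sco \<Rightarrow> sco" where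
  "sappend (SCons u l) l' = SCons u (sappend l l')"
| "sappend (SAbs (SApp t l)) l' = SAbs (SApp t (sappend l (sclift l')))"
| "sappend (SAbs V) l' = SAbs (SApp V (sclift l'))"

inductive sred :: "stm \<Rightarrow> stm \<Rightarrow> bool" and scred :: "sco \<Rightarrow> sco \<Rightarrow> bool" where
  beta: "sred (SApp (SLam t) (SCons u l)) (SApp u (SAbs (SApp t (sclift l))))"
| sigma: "sred (SApp t (SAbs v)) (sinst t v)"
| pi: "sred (SApp (SApp t l) (SCons u l')) (SApp t (sappend l (SCons u l')))"
| mu: "scred (SAbs (SApp (SVar 0) (sclift l))) l"
| Lam: "sred t t' \<Longrightarrow> sred (SLam t) (SLam t')"
| App1: "sred t t' \<Longrightarrow> sred (SApp t l) (SApp t' l)"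
| App2: "scred l l' \<Longrightarrow> sred (SApp t l) (SApp t l')"
| Cons1: "sred u u' \<Longrightarrow> scred (SCons u l) (SCons u' l)"
| Cons2: "scred l l' \<Longrightarrow> scred (SCons u l) (SCons u l')"
| Abs: "sred v v' \<Longrightarrow> scred (SAbs v) (SAbs v')"

lemma size_sren [simp]: "size (sren \<rho> t) = size t"
  and size_scren [simp]: "size (scren \<rho> l) = size l"
  by (induction t and l arbitrary: \<rho> and \<rho>) auto

text \<open>\<open>scol s t G K\<close> is \<open>(t : G, K)\<close>, \<open>sccol s l G K\<close> is \<open>(l : G, K)\<close>, and
  \<open>ssemi s t l G K\<close> is \<open>(t l; G, K)\<close>. In the equation for \<open>SAbs V\<close>, \<open>V\<close> ranges over the values
  only, since the equations are sequential.\<close>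

function (sequential)
      sbar :: "lam \<Rightarrow> stm \<Rightarrow> lam"
  and scol :: "lam \<Rightarrow> stm \<Rightarrow> lam \<Rightarrow> lam \<Rightarrow> lam"
  and sccol :: "lam \<Rightarrow> sco \<Rightarrow> lam \<Rightarrow> lam \<Rightarrow> lam"
  and ssemi :: "lam \<Rightarrow> stm \<Rightarrow> sco \<Rightarrow> lam \<Rightarrow> lam \<Rightarrow> lam" where
  "sbar s t = Lam (Lam (scol s (slift (slift t)) (Var 1) (Var 0)))"
| "scol s (SVar x) G K = App (App (Var x) (App s G)) K"
| "scol s (SLam t) G K = brk (App K (wabs (sbar s t))) G"
| "scol s (SApp t l) G K = ssemi s t l (App s G) K"
| "sccol s (SCons u l) G K = mpair G (mpair (sccol s l G K) (sbar s u))"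
| "sccol s (SAbs (SApp t l)) G K = Lam (ssemi s t l (lift G) (lift K))"
| "sccol s (SAbs V) G K = Lam (scol s V (lift G) (lift K))"
| "ssemi s t (SAbs v) G K = App (sccol s (SAbs v) G K) (sbar s t)"
| "ssemi s t (SCons u l) G K = scol s t G (mpair (sccol s l G K) (sbar s u))"
  by pat_completeness auto
termination
  by (relation "measure (\<lambda>p. case p of
                     Inl (Inl (s, t)) \<Rightarrow> 3 * size t + 1
                   | Inl (Inr (s, t, G, K)) \<Rightarrow> 3 * size t
                   | Inr (Inl (s, l, G, K)) \<Rightarrow> 3 * size l
                   | Inr (Inr (s, t, l, G, K)) \<Rightarrow> 3 * size t + 3 * size l + 2)") auto

end

theory Submission
  imports Defs
begin

text \<open>
  Reading \<open>t(u, x.v)\<close> as \<open>t(u, (x)v)\<close> embeds \<open>\<lambda>J\<close> into \<open>\<lambda>J\<^sup>m\<close>, and reading \<open>t(u, l)\<close> as \<open>t(u :: l)\<close>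
  embeds \<open>\<lambda>J\<^sup>m\<close> into \<open>\<lambda>J\<^sup>m\<^sup>s\<close>. Both embeddings commute with the translations and map a reduction step
  to at least one step (the two \<open>\<beta>\<close>-rules of \<open>\<lambda>J\<^sup>m\<close> become \<open>\<beta>\<close> followed by \<open>\<sigma>\<close>-steps), so only \<open>\<lambda>J\<^sup>m\<^sup>s\<close>
  has to be simulated. There \<open>(t:G,K)\<close> is strictly monotone in \<open>G\<close> and \<open>K\<close>, and substituting \<open>t\<close>
  translated for \<open>x\<close> in \<open>(v:G,K)\<close> gives a term that reduces to \<open>([t/x]v:G,K)\<close>: when a variable is
  replaced, the superfluous garbage \<open>s G\<close> reduces to \<open>G\<close>. Because \<open>((x)v:G,K)\<close> treats values and
  applications \<open>v\<close> differently, and a reduction can turn an application into a value, the simulation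
  is proved for the bodies of \<open>((x)v:G,K)\<close> rather than for \<open>(v:G,K)\<close>.
\<close>


section \<open>Renaming, substitution and \<open>\<beta>\<close>-reduction of lambda-terms\<close>

lemma up_ren_simps [simp]:
  "up_ren \<rho> 0 = 0" "up_ren \<rho> (Suc n) = Suc (\<rho> n)"
  by (simp_all add: up_ren_def)

lemma up_ren_id [simp]: "up_ren (\<lambda>n. n) = (\<lambda>n. n)"
  by (auto simp: up_ren_def fun_eq_iff split: nat.split)

lemma up_ren_comp: "(\<lambda>n. up_ren \<rho> (up_ren \<rho>' n)) = up_ren (\<lambda>n. \<rho> (\<rho>' n))"
  by (auto simp: up_ren_def fun_eq_iff split: nat.split)

lemma case_nat_up_ren: "(\<lambda>n. case_nat a f (up_ren \<rho> n)) = case_nat a (\<lambda>n. f (\<rho> n))"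
  by (auto simp: up_ren_def fun_eq_iff split: nat.split)

lemma ren_ren [simp]: "ren \<rho> (ren \<rho>' t) = ren (\<lambda>n. \<rho> (\<rho>' n)) t"
  by (induction t arbitrary: \<rho> \<rho>') (simp_all add: up_ren_comp)

lemma subst_ren [simp]: "subst \<sigma> (ren \<rho> t) = subst (\<lambda>n. \<sigma> (\<rho> n)) t"
  by (induction t arbitrary: \<sigma> \<rho>) (simp_all add: case_nat_up_ren)

lemma ren_case_nat:
  "(\<lambda>n. ren (up_ren \<rho>) (case_nat (Var 0) (\<lambda>n. lift (\<sigma> n)) n)) =
   case_nat (Var 0) (\<lambda>n. lift (ren \<rho> (\<sigma> n)))"
  by (auto simp: fun_eq_iff split: nat.split)

lemma ren_subst: "ren \<rho> (subst \<sigma> t) = subst (\<lambda>n. ren \<rho> (\<sigma> n)) t"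
  by (induction t arbitrary: \<sigma> \<rho>) (simp_all add: ren_case_nat)

lemma case_nat_Var: "case_nat (Var 0) (\<lambda>n. Var (Suc n)) = Var"
  by (auto simp: fun_eq_iff split: nat.split)

lemma subst_Var [simp]: "subst Var t = t"
  by (induction t) (simp_all add: case_nat_Var)

text \<open>Lets facts proved for substitutions be reused for renamings, here for
  \<open>mpair\<close>, for closed terms and for the translation.\<close>

lemma ren_conv_subst: "ren \<rho> t = subst (\<lambda>n. Var (\<rho> n)) t"
  by (metis subst_ren subst_Var)

lemma subst_cong_fv: "(\<And>n. n \<in> fv t \<Longrightarrow> \<sigma> n = \<sigma>' n) \<Longrightarrow> subst \<sigma> t = subst \<sigma>' t"
proof (induction t arbitrary: \<sigma> \<sigma>')
  case (Lam t)
  have "subst (case_nat (Var 0) (\<lambda>n. lift (\<sigma> n))) t = subst (case_nat (Var 0) (\<lambda>n. lift (\<sigma>' n))) t"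
    by (rule Lam.IH) (use Lam.prems in \<open>auto split: nat.split\<close>)
  then show ?case by simp
next
  case (App t u)
  then have "subst \<sigma> t = subst \<sigma>' t" "subst \<sigma> u = subst \<sigma>' u"
    by (metis UnCI fv.simps(3))+
  then show ?case by simp
qed simp

lemma closed_subst: "closed t \<Longrightarrow> subst \<sigma> t = t"
  using subst_cong_fv [of t \<sigma> Var] by (simp add: closed_def)

lemma closed_ren: "closed t \<Longrightarrow> ren \<rho> t = t"
  by (simp add: ren_conv_subst closed_subst)

lemma inst_lift [simp]: "inst u (lift t) = t"
  by (simp add: inst_def)

lemma ren_inst: "ren \<rho> (inst u t) = inst (ren \<rho> u) (ren (up_ren \<rho>) t)"
proof -
  have "(\<lambda>n. ren \<rho> (case_nat u Var n)) = case_nat (ren \<rho> u) (\<lambda>n. Var (\<rho> n))"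
    by (auto simp: fun_eq_iff split: nat.split)
  then show ?thesis
    by (simp add: inst_def ren_subst case_nat_up_ren)
qed

lemma subst_brk [simp]: "subst \<sigma> (brk t u) = brk (subst \<sigma> t) (subst \<sigma> u)"
  by (simp add: brk_def ren_subst)

lemma subst_mpair [simp]: "subst \<sigma> (mpair L U) = mpair (subst \<sigma> L) (subst \<sigma> U)"
  by (simp add: mpair_def ren_subst)

lemma ren_mpair [simp]: "ren \<rho> (mpair L U) = mpair (ren \<rho> L) (ren \<rho> U)"
  by (simp add: ren_conv_subst)

lemma subst_wabs [simp]:
  "subst \<sigma> (wabs b) = wabs (subst (case_nat (Var 0) (\<lambda>n. lift (\<sigma> n))) b)"
proof -
  have "(\<lambda>n. ren (up_ren Suc) (case_nat (Var 0) (\<lambda>n. lift (\<sigma> n)) n)) =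
        case_nat (Var 0) (\<lambda>n. lift (lift (\<sigma> n)))"
    by (auto simp: fun_eq_iff split: nat.split)
  then show ?thesis
    by (simp add: wabs_def ren_subst case_nat_up_ren)
qed

section \<open>Closure of beta-reduction sequences under contexts\<close>

lemma beta_ren: "beta t u \<Longrightarrow> beta (ren \<rho> t) (ren \<rho> u)"
proof (induction arbitrary: \<rho> rule: beta.induct)
  case (beta t u)
  show ?case using beta.beta by (simp add: ren_inst)
qed (auto intro: beta.intros)

lemma tranclp_map:
  assumes "R\<^sup>+\<^sup>+ x y" "\<And>x y. R x y \<Longrightarrow> S (f x) (f y)"
  shows "S\<^sup>+\<^sup>+ (f x) (f y)"
  using assms(1)
proof induction
  case (base y)
  then show ?case by (intro tranclp.r_into_trancl assms(2))
next
  case (step y z)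
  then show ?case using assms(2) by (metis tranclp.trancl_into_trancl)
qed

abbreviation betas (infix "\<rightarrow>\<^sup>*" 50) where "t \<rightarrow>\<^sup>* u \<equiv> beta\<^sup>*\<^sup>* t u"
abbreviation betap (infix "\<rightarrow>\<^sup>+" 50) where "t \<rightarrow>\<^sup>+ u \<equiv> beta\<^sup>+\<^sup>+ t u"

text \<open>A reduction sequence is either empty or strict, so every strict monotonicity result
  yields its reflexive version for free.\<close>

lemma betas_map:
  assumes "x \<rightarrow>\<^sup>* y" "\<And>x y. x \<rightarrow>\<^sup>+ y \<Longrightarrow> f x \<rightarrow>\<^sup>+ f y"
  shows "f x \<rightarrow>\<^sup>* f y"
  using assms(1) by (auto simp: Nitpick.rtranclp_unfold dest: assms(2))

lemma betap_LamI: "t \<rightarrow>\<^sup>+ t' \<Longrightarrow> Lam t \<rightarrow>\<^sup>+ Lam t'"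
  by (erule tranclp_map [where f = Lam]) (rule beta.intros)

lemma betap_AppL: "t \<rightarrow>\<^sup>+ t' \<Longrightarrow> App t u \<rightarrow>\<^sup>+ App t' u"
  by (erule tranclp_map [where f = "\<lambda>t. App t u"]) (rule beta.intros)

lemma betap_AppR: "u \<rightarrow>\<^sup>+ u' \<Longrightarrow> App t u \<rightarrow>\<^sup>+ App t u'"
  by (erule tranclp_map [where f = "App t"]) (rule beta.intros)

lemma betap_ren: "t \<rightarrow>\<^sup>+ t' \<Longrightarrow> ren \<rho> t \<rightarrow>\<^sup>+ ren \<rho> t'"
  by (erule tranclp_map [where f = "ren \<rho>"]) (rule beta_ren)

lemmas betap_intros = betap_LamI betap_AppL betap_AppR betap_ren

lemma betap_brkL: "t \<rightarrow>\<^sup>+ t' \<Longrightarrow> brk t u \<rightarrow>\<^sup>+ brk t' u"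
  and betap_brkR: "u \<rightarrow>\<^sup>+ u' \<Longrightarrow> brk t u \<rightarrow>\<^sup>+ brk t u'"
  and betap_mpairL: "L \<rightarrow>\<^sup>+ L' \<Longrightarrow> mpair L U \<rightarrow>\<^sup>+ mpair L' U"
  and betap_mpairR: "U \<rightarrow>\<^sup>+ U' \<Longrightarrow> mpair L U \<rightarrow>\<^sup>+ mpair L U'"
  and betap_wabs: "t \<rightarrow>\<^sup>+ t' \<Longrightarrow> wabs t \<rightarrow>\<^sup>+ wabs t'"
  by (auto simp: brk_def mpair_def wabs_def intro!: betap_intros)

lemmas betap_cong = betap_intros betap_brkL betap_brkR betap_mpairL betap_mpairR betap_wabs

lemma betas_LamI: "t \<rightarrow>\<^sup>* t' \<Longrightarrow> Lam t \<rightarrow>\<^sup>* Lam t'"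
  by (erule betas_map [where f = Lam]) (rule betap_LamI)

lemma betas_App: "t \<rightarrow>\<^sup>* t' \<Longrightarrow> u \<rightarrow>\<^sup>* u' \<Longrightarrow> App t u \<rightarrow>\<^sup>* App t' u'"
  by (rule rtranclp_trans [of _ _ "App t' u"],
      erule betas_map [where f = "\<lambda>t. App t u"], rule betap_AppL, assumption,
      erule betas_map [where f = "App t'"], rule betap_AppR, assumption)

lemma betas_ren: "t \<rightarrow>\<^sup>* t' \<Longrightarrow> ren \<rho> t \<rightarrow>\<^sup>* ren \<rho> t'"
  by (erule betas_map [where f = "ren \<rho>"]) (rule betap_ren)

lemma betas_brk: "t \<rightarrow>\<^sup>* t' \<Longrightarrow> u \<rightarrow>\<^sup>* u' \<Longrightarrow> brk t u \<rightarrow>\<^sup>* brk t' u'"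
  by (auto simp: brk_def intro!: betas_App betas_LamI betas_ren)

lemma betas_mpair: "L \<rightarrow>\<^sup>* L' \<Longrightarrow> U \<rightarrow>\<^sup>* U' \<Longrightarrow> mpair L U \<rightarrow>\<^sup>* mpair L' U'"
  by (auto simp: mpair_def intro!: betas_App betas_LamI betas_ren)

lemma betas_wabs: "t \<rightarrow>\<^sup>* t' \<Longrightarrow> wabs t \<rightarrow>\<^sup>* wabs t'"
  by (auto simp: wabs_def intro!: betas_App betas_LamI betas_ren)

lemmas betas_cong = betas_LamI betas_App betas_ren betas_brk betas_mpair betas_wabs

section \<open>Administrative steps that drop garbage and unpack continuations\<close>

lemma beta_brk: "beta (brk t u) t"
  using beta.beta [of "lift t" u] by (simp add: brk_def)

lemma beta_mpair: "beta (App (mpair L U) t) (App (App t L) U)"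
proof -
  have "inst t (App (App (Var 0) (lift L)) (lift U)) = App (App t L) U"
    by (simp add: inst_def)
  then show ?thesis
    using beta.beta [of "App (App (Var 0) (lift L)) (lift U)" t] by (simp add: mpair_def)
qed

lemma beta_wabs: "beta (App (wabs b) L) (Lam (App (lift L) b))"
proof -
  have "inst L (Lam (App (Var 1) (ren (up_ren Suc) b))) = Lam (App (lift L) b)"
    by (simp add: inst_def case_nat_up_ren case_nat_Var)
  then show ?thesis
    using beta.beta [of "Lam (App (Var 1) (ren (up_ren Suc) b))" L] by (simp add: wabs_def)
qed


section \<open>Renaming and substitution in \<open>\<lambda>J\<^sup>m\<^sup>s\<close>\<close>

lemma sren_sren [simp]: "sren \<rho> (sren \<rho>' t) = sren (\<lambda>n. \<rho> (\<rho>' n)) t"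
  and scren_scren [simp]: "scren \<rho> (scren \<rho>' l) = scren (\<lambda>n. \<rho> (\<rho>' n)) l"
  by (induction t and l arbitrary: \<rho> \<rho>' and \<rho> \<rho>') (simp_all add: up_ren_comp)

lemma sren_id [simp]: "sren (\<lambda>n. n) t = t"
  and scren_id [simp]: "scren (\<lambda>n. n) l = l"
  by (induction t and l) simp_all

lemma ssubst_sren [simp]: "ssubst \<sigma> (sren \<rho> t) = ssubst (\<lambda>n. \<sigma> (\<rho> n)) t"
  and scsubst_scren [simp]: "scsubst \<sigma> (scren \<rho> l) = scsubst (\<lambda>n. \<sigma> (\<rho> n)) l"
  by (induction t and l arbitrary: \<sigma> \<rho> and \<sigma> \<rho>) (simp_all add: case_nat_up_ren)

lemma sren_case_nat:
  "(\<lambda>n. sren (up_ren \<rho>) (case_nat (SVar 0) (\<lambda>n. slift (\<sigma> n)) n)) =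
   case_nat (SVar 0) (\<lambda>n. slift (sren \<rho> (\<sigma> n)))"
  by (auto simp: fun_eq_iff split: nat.split)

lemma sren_ssubst: "sren \<rho> (ssubst \<sigma> t) = ssubst (\<lambda>n. sren \<rho> (\<sigma> n)) t"
  and scren_scsubst: "scren \<rho> (scsubst \<sigma> l) = scsubst (\<lambda>n. sren \<rho> (\<sigma> n)) l"
  by (induction t and l arbitrary: \<sigma> \<rho> and \<sigma> \<rho>) (simp_all add: sren_case_nat)

lemma case_nat_SVar: "case_nat (SVar 0) (\<lambda>n. SVar (Suc n)) = SVar"
  by (auto simp: fun_eq_iff split: nat.split)

lemma ssubst_SVar [simp]: "ssubst SVar t = t"
  and scsubst_SVar [simp]: "scsubst SVar l = l"
  by (induction t and l) (simp_all add: case_nat_SVar)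

lemma sren_sinst: "sren \<rho> (sinst u t) = sinst (sren \<rho> u) (sren (up_ren \<rho>) t)"
proof -
  have "(\<lambda>n. sren \<rho> (case_nat u SVar n)) = case_nat (sren \<rho> u) (\<lambda>n. SVar (\<rho> n))"
    by (auto simp: fun_eq_iff split: nat.split)
  then show ?thesis
    by (simp add: sinst_def sren_ssubst case_nat_up_ren)
qed

lemma scren_sappend: "scren \<rho> (sappend l l') = sappend (scren \<rho> l) (scren \<rho> l')"
  by (induction l l' arbitrary: \<rho> rule: sappend.induct) simp_all

text \<open>The induction rule of the translation without \<open>s\<close>, \<open>G\<close> and \<open>K\<close>: this keeps \<open>s\<close> fixed.\<close>

lemma translation_induct [case_names bar Var Lam App Cons Abs_App Abs_Var Abs_Lam semi_Abs semi_Cons]: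
  assumes "\<And>t. Q (slift (slift t)) \<Longrightarrow> P t"
    and "\<And>x. Q (SVar x)" "\<And>t. P t \<Longrightarrow> Q (SLam t)" "\<And>t l. U t l \<Longrightarrow> Q (SApp t l)"
    and "\<And>u l. R l \<Longrightarrow> P u \<Longrightarrow> R (SCons u l)" "\<And>t l. U t l \<Longrightarrow> R (SAbs (SApp t l))"
    and "\<And>x. Q (SVar x) \<Longrightarrow> R (SAbs (SVar x))" "\<And>t. Q (SLam t) \<Longrightarrow> R (SAbs (SLam t))"
    and "\<And>t v. R (SAbs v) \<Longrightarrow> P t \<Longrightarrow> U t (SAbs v)"
    and "\<And>t u l. R l \<Longrightarrow> P u \<Longrightarrow> Q t \<Longrightarrow> U t (SCons u l)"
  shows "P t1" "Q t2" "R l1" "U t3 l2"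
  using sbar_scol_sccol_ssemi.induct
    [where P = "\<lambda>_ t. P t" and Q = "\<lambda>_ t _ _. Q t" and R = "\<lambda>_ l _ _. R l"
       and S = "\<lambda>_ t l _ _. U t l", OF assms]
  by simp_all


text \<open>For claims in which only \<open>G\<close> and \<open>K\<close> vary: barred subterms do
  not depend on them, so their induction hypotheses disappear.\<close>

lemma translation_induct_no_bar [case_names Var Lam App Cons Abs_App Abs_Var Abs_Lam semi_Abs semi_Cons]:
  assumes "\<And>x. Q (SVar x)" "\<And>t. Q (SLam t)" "\<And>t l. U t l \<Longrightarrow> Q (SApp t l)"
    and "\<And>u l. R l \<Longrightarrow> R (SCons u l)" "\<And>t l. U t l \<Longrightarrow> R (SAbs (SApp t l))"
    and "\<And>x. Q (SVar x) \<Longrightarrow> R (SAbs (SVar x))" "\<And>t. Q (SLam t) \<Longrightarrow> R (SAbs (SLam t))"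
    and "\<And>t v. R (SAbs v) \<Longrightarrow> U t (SAbs v)"
    and "\<And>t u l. R l \<Longrightarrow> Q t \<Longrightarrow> U t (SCons u l)"
  shows "Q t1" "R l1" "U t2 l2"
  using translation_induct(2-4) [where P = "\<lambda>_. True" and Q = Q and R = R and U = U, OF TrueI assms]
  by simp_all

section \<open>The translation of \<open>\<lambda>J\<^sup>m\<^sup>s\<close>\<close>

declare sbar.simps [simp del]

text \<open>\<open>sacol s t G K\<close> is the paper's \<open>(t;G,K)\<close> on applications, extended by \<open>(V:G,K)\<close> on values.
  This is the body of \<open>((x)t:G,K)\<close>.\<close>

fun sacol :: "lam \<Rightarrow> stm \<Rightarrow> lam \<Rightarrow> lam \<Rightarrow> lam" where
  "sacol s (SApp t l) G K = ssemi s t l G K"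
| "sacol s V G K = scol s V G K"

lemma sccol_SAbs: "sccol s (SAbs v) G K = Lam (sacol s v (lift G) (lift K))"
  by (cases v) simp_all

locale garbage_combinator =
  fixes s :: lam
  assumes closed: "closed s"
    and garbage: "App s G \<rightarrow>\<^sup>+ G"
begin

section \<open>Renaming the term, and instantiating its garbage and continuation\<close>

lemma subst_s [simp]: "subst \<sigma> s = s"
  using closed by (rule closed_subst)

lemma ren_s [simp]: "ren \<rho> s = s"
  using closed by (rule closed_ren)

text \<open>Covers two uses at once: a pure renaming, where \<open>\<rho>\<close> is the identity,
  and the substitution for \<open>g\<close> and \<open>k\<close>, which do not occur in a term
  lifted by \<open>\<rho>\<close>.\<close>

definition renames :: "(nat \<Rightarrow> lam) \<Rightarrow> (nat \<Rightarrow> nat) \<Rightarrow> (nat \<Rightarrow> nat) \<Rightarrow> bool" where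
  "renames \<sigma> \<rho> \<rho>' \<longleftrightarrow> (\<forall>n. \<sigma> (\<rho> n) = Var (\<rho>' n))"

lemma renames_up:
  "renames \<sigma> \<rho> \<rho>' \<Longrightarrow> renames (case_nat (Var 0) (\<lambda>n. lift (\<sigma> n))) (up_ren \<rho>) (up_ren \<rho>')"
  by (auto simp: renames_def up_ren_def split: nat.split)

text \<open>Equality holds because variables of the source term are only replaced by variables.
  Translated terms put in their place yield merely a reduction.\<close>

lemma subst_translation_sren:
  shows "renames \<sigma> \<rho> \<rho>' \<Longrightarrow> subst \<sigma> (sbar s (sren \<rho> t1)) = sbar s (sren \<rho>' t1)"
    and "renames \<sigma> \<rho> \<rho>' \<Longrightarrow>
      subst \<sigma> (scol s (sren \<rho> t) G K) = scol s (sren \<rho>' t) (subst \<sigma> G) (subst \<sigma> K)"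
    and "renames \<sigma> \<rho> \<rho>' \<Longrightarrow>
      subst \<sigma> (sccol s (scren \<rho> l) G K) = sccol s (scren \<rho>' l) (subst \<sigma> G) (subst \<sigma> K)"
    and "renames \<sigma> \<rho> \<rho>' \<Longrightarrow>
      subst \<sigma> (ssemi s (sren \<rho> t2) (scren \<rho> l2) G K) =
        ssemi s (sren \<rho>' t2) (scren \<rho>' l2) (subst \<sigma> G) (subst \<sigma> K)"
proof (induction t1 and t and l and t2 l2 arbitrary: \<sigma> \<rho> \<rho>' and \<sigma> \<rho> \<rho>' G K and \<sigma> \<rho> \<rho>' G K
    and \<sigma> \<rho> \<rho>' G K rule: translation_induct)
  case (bar t)
  show ?case
    using bar.IH [OF renames_up [OF renames_up [OF bar.prems]], of "Var 1" "Var 0"]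
    by (simp add: sbar.simps)
next
  case (Lam t)
  show ?case using Lam.IH [OF renames_up [OF Lam.prems]] by simp
next
  case (Abs_App t l)
  show ?case
    using Abs_App.IH [OF renames_up [OF Abs_App.prems], of "lift G" "lift K"] by (simp add: ren_subst)
next
  case (Abs_Var x)
  show ?case
    using Abs_Var.IH [OF renames_up [OF Abs_Var.prems], of "lift G" "lift K"] by (simp add: ren_subst)
next
  case (Abs_Lam t)
  show ?case
    using Abs_Lam.IH [OF renames_up [OF Abs_Lam.prems], of "lift G" "lift K"] by (simp add: ren_subst)
next
  case (Var x)
  then show ?case by (simp add: renames_def)
qed simp_all

lemma ren_sbar: "ren \<rho> (sbar s t) = sbar s (sren \<rho> t)"
  using subst_translation_sren(1) [of "\<lambda>n. Var (\<rho> n)" "\<lambda>n. n" \<rho> t] by (simp add: renames_def ren_conv_subst)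

lemma ren_sccol: "ren \<rho> (sccol s l G K) = sccol s (scren \<rho> l) (ren \<rho> G) (ren \<rho> K)"
  using subst_translation_sren(3) [of "\<lambda>n. Var (\<rho> n)" "\<lambda>n. n" \<rho> l]
  by (simp add: renames_def ren_conv_subst)

text \<open>The two contractions instantiate \<open>g\<close> and \<open>k\<close>. Since
  \<open>t\<close> was lifted past both, each of them only undoes one lifting of
  \<open>t\<close>.\<close>

lemma betap_sbar_App: "App (App (sbar s t) G) K \<rightarrow>\<^sup>+ scol s t G K"
proof -
  let ?\<sigma> = "case_nat (Var 0) (\<lambda>n. lift (case_nat G Var n))"
  \<comment> \<open>Contracting the redex for \<open>g\<close> takes place under the binder of
    \<open>k\<close>: \<open>G\<close> gets lifted and one of the two liftings of \<open>t\<close>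
    remains.\<close>
  have "subst ?\<sigma> (scol s (sren (\<lambda>n. Suc (Suc n)) t) (Var 1) (Var 0)) =
      scol s (sren Suc t) (lift G) (Var 0)"
    by (subst subst_translation_sren(2) [where \<rho>' = Suc]) (simp_all add: renames_def)
  then have "beta (App (sbar s t) G) (Lam (scol s (sren Suc t) (lift G) (Var 0)))"
    using beta.beta [of "Lam (scol s (sren (\<lambda>n. Suc (Suc n)) t) (Var 1) (Var 0))" G]
    by (simp add: sbar.simps inst_def)
  moreover have "inst K (scol s (sren Suc t) (lift G) (Var 0)) = scol s (sren (\<lambda>n. n) t) G K"
    unfolding inst_def by (subst subst_translation_sren(2) [where \<rho>' = "\<lambda>n. n"]) (simp_all add: renames_def)
  then have "beta (App (Lam (scol s (sren Suc t) (lift G) (Var 0))) K) (scol s t G K)"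
    using beta.beta [of "scol s (sren Suc t) (lift G) (Var 0)" K] by simp
  ultimately show ?thesis
    by (metis beta.AppL tranclp.r_into_trancl tranclp.trancl_into_trancl)
qed

section \<open>Strict monotonicity in continuation and garbage\<close>

lemma betap_translation_K:
  shows "K \<rightarrow>\<^sup>+ K' \<Longrightarrow> scol s t G K \<rightarrow>\<^sup>+ scol s t G K'"
    and "K \<rightarrow>\<^sup>+ K' \<Longrightarrow> sccol s l G K \<rightarrow>\<^sup>+ sccol s l G K'"
    and "K \<rightarrow>\<^sup>+ K' \<Longrightarrow> ssemi s t2 l2 G K \<rightarrow>\<^sup>+ ssemi s t2 l2 G K'"
  by (induction t and l and t2 l2 arbitrary: K K' G and K K' G and K K' G
      rule: translation_induct_no_bar) (simp_all add: betap_cong)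

text \<open>No clause of the translation discards its garbage argument, which gives strictness. The
  clauses for \<open>SCons\<close> use it twice, so there the inner copy is reduced before the outer
  one.\<close>

lemma betap_translation_G:
  shows "G \<rightarrow>\<^sup>+ G' \<Longrightarrow> scol s t G K \<rightarrow>\<^sup>+ scol s t G' K"
    and "G \<rightarrow>\<^sup>+ G' \<Longrightarrow> sccol s l G K \<rightarrow>\<^sup>+ sccol s l G' K"
    and "G \<rightarrow>\<^sup>+ G' \<Longrightarrow> ssemi s t2 l2 G K \<rightarrow>\<^sup>+ ssemi s t2 l2 G' K"
proof (induction t and l and t2 l2 arbitrary: K G G' and K G G' and K G G'
      rule: translation_induct_no_bar)
  case (Cons u l)
  have "sccol s (SCons u l) G K \<rightarrow>\<^sup>+ mpair G (mpair (sccol s l G' K) (sbar s u))"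
    using Cons by (simp add: betap_cong)
  also have "mpair G (mpair (sccol s l G' K) (sbar s u)) \<rightarrow>\<^sup>+ sccol s (SCons u l) G' K"
    using Cons by (simp add: betap_cong)
  finally show ?case .
next
  case (semi_Cons t u l)
  have "ssemi s t (SCons u l) G K \<rightarrow>\<^sup>+ scol s t G (mpair (sccol s l G' K) (sbar s u))"
    using semi_Cons by (simp add: betap_cong betap_translation_K)
  also have "\<dots> \<rightarrow>\<^sup>+ ssemi s t (SCons u l) G' K"
    using semi_Cons by (simp add: betap_cong)
  finally show ?case .
qed (simp_all add: betap_cong)

lemma betas_scol:
  assumes "G \<rightarrow>\<^sup>* G'" "K \<rightarrow>\<^sup>* K'"
  shows "scol s t G K \<rightarrow>\<^sup>* scol s t G' K'"
proof -
  have "scol s t G K \<rightarrow>\<^sup>* scol s t G' K"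
    by (rule betas_map [where f = "\<lambda>G. scol s t G K", OF assms(1)]) (rule betap_translation_G)
  also have "\<dots> \<rightarrow>\<^sup>* scol s t G' K'"
    by (rule betas_map [where f = "scol s t G'", OF assms(2)]) (rule betap_translation_K)
  finally show ?thesis .
qed

text \<open>Values have the same image on both sides; for an application the left side has one
  surplus \<open>App s\<close> around the garbage.\<close>

lemma betas_scol_sacol: "scol s t G K \<rightarrow>\<^sup>* sacol s t G K"
  by (cases t) (simp_all add: betap_translation_G(3) garbage tranclp_into_rtranclp)

text \<open>Here applications agree exactly, and the surplus \<open>App s\<close> sits on
  values.\<close>

lemma betas_sacol_scol: "sacol s t (App s G) K \<rightarrow>\<^sup>* scol s t G K"
  by (cases t) (simp_all add: betap_translation_G(1) garbage tranclp_into_rtranclp del: scol.simps(1,2))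

section \<open>Substitution up to reduction\<close>

text \<open>Below a binder, the bound variable is mapped to itself; its translation is only an
  \<open>\<eta>\<close>-expansion of it. Hence the second disjunct.\<close>

definition translates_subst :: "(nat \<Rightarrow> lam) \<Rightarrow> (nat \<Rightarrow> stm) \<Rightarrow> bool" where
  "translates_subst \<sigma> \<tau> \<longleftrightarrow> (\<forall>n. \<sigma> n = sbar s (\<tau> n) \<or> (\<exists>m. \<sigma> n = Var m \<and> \<tau> n = SVar m))"

lemma translates_subst_up:
  assumes "translates_subst \<sigma> \<tau>"
  shows "translates_subst (case_nat (Var 0) (\<lambda>n. lift (\<sigma> n))) (case_nat (SVar 0) (\<lambda>n. slift (\<tau> n)))"
  unfolding translates_subst_def
proof
  fix n
  show "case_nat (Var 0) (\<lambda>n. lift (\<sigma> n)) n = sbar s (case_nat (SVar 0) (\<lambda>n. slift (\<tau> n)) n) \<or>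
    (\<exists>m. case_nat (Var 0) (\<lambda>n. lift (\<sigma> n)) n = Var m \<and>
         case_nat (SVar 0) (\<lambda>n. slift (\<tau> n)) n = SVar m)"
  proof (cases n)
    case (Suc m)
    then show ?thesis
      using assms [unfolded translates_subst_def, rule_format, of m] by (auto simp: ren_sbar)
  qed simp
qed

text \<open>Only a reduction is available: a replaced variable leaves a barred term applied to
  garbage and continuation, which must be contracted, and the \<open>App s\<close> of the variable
  clause must be removed.\<close>

lemma betas_subst_translation:
  shows "translates_subst \<sigma> \<tau> \<Longrightarrow> subst \<sigma> (sbar s t1) \<rightarrow>\<^sup>* sbar s (ssubst \<tau> t1)"
    and "translates_subst \<sigma> \<tau> \<Longrightarrow>
      subst \<sigma> (scol s t G K) \<rightarrow>\<^sup>* scol s (ssubst \<tau> t) (subst \<sigma> G) (subst \<sigma> K)"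
    and "translates_subst \<sigma> \<tau> \<Longrightarrow>
      subst \<sigma> (sccol s l G K) \<rightarrow>\<^sup>* sccol s (scsubst \<tau> l) (subst \<sigma> G) (subst \<sigma> K)"
    and "translates_subst \<sigma> \<tau> \<Longrightarrow>
      subst \<sigma> (ssemi s t2 l2 G K) \<rightarrow>\<^sup>*
        ssemi s (ssubst \<tau> t2) (scsubst \<tau> l2) (subst \<sigma> G) (subst \<sigma> K)"
proof (induction t1 and t and l and t2 l2 arbitrary: \<sigma> \<tau> and \<sigma> \<tau> G K and \<sigma> \<tau> G K and \<sigma> \<tau> G K
    rule: translation_induct)
  case (bar t)
  show ?case
    using bar.IH [OF translates_subst_up [OF translates_subst_up [OF bar.prems]], of "Var 1" "Var 0"]
    by (simp add: sbar.simps sren_ssubst betas_LamI)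
next
  case (Var x)
  from Var [unfolded translates_subst_def, rule_format, of x] show ?case
  proof
    assume "\<sigma> x = sbar s (\<tau> x)"
    then have "subst \<sigma> (scol s (SVar x) G K) \<rightarrow>\<^sup>* scol s (\<tau> x) (App s (subst \<sigma> G)) (subst \<sigma> K)"
      using betap_sbar_App by (simp add: tranclp_into_rtranclp)
    also have "\<dots> \<rightarrow>\<^sup>* scol s (\<tau> x) (subst \<sigma> G) (subst \<sigma> K)"
      by (intro betas_scol tranclp_into_rtranclp [OF garbage] rtranclp.rtrancl_refl)
    finally show ?thesis by simp
  qed auto
next
  case (Lam t)
  show ?case
    using Lam.IH [OF translates_subst_up [OF Lam.prems]]
    by (simp, intro betas_cong rtranclp.rtrancl_refl)
next
  case (App t l)
  show ?case using App.IH [OF App.prems, of "App s G"] by simp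
next
  case (Cons u l)
  show ?case
    by (simp, intro betas_cong rtranclp.rtrancl_refl Cons.IH [OF Cons.prems])
next
  case (Abs_App t l)
  show ?case
    using Abs_App.IH [OF translates_subst_up [OF Abs_App.prems], of "lift G" "lift K"]
    by (simp add: ren_subst betas_LamI)
next
  case (Abs_Var x)
  \<comment> \<open>The substituted term may be an application, in which case \<open>sccol\<close>
    switches from its clause for values to the one through \<open>ssemi\<close>. The lemma
    \<open>betas_scol_sacol\<close> bridges the difference in garbage.\<close>
  define t where "t = case_nat (SVar 0) (\<lambda>n. slift (\<tau> n)) x"
  have "subst \<sigma> (sccol s (SAbs (SVar x)) G K) =
      Lam (subst (case_nat (Var 0) (\<lambda>n. lift (\<sigma> n))) (scol s (SVar x) (lift G) (lift K)))"
    by simp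
  moreover have "subst (case_nat (Var 0) (\<lambda>n. lift (\<sigma> n))) (scol s (SVar x) (lift G) (lift K)) \<rightarrow>\<^sup>*
      scol s t (lift (subst \<sigma> G)) (lift (subst \<sigma> K))"
    using Abs_Var.IH [OF translates_subst_up [OF Abs_Var.prems], of "lift G" "lift K"]
    by (simp only: ssubst.simps subst_ren ren_subst nat.case t_def)
  moreover have "sccol s (scsubst \<tau> (SAbs (SVar x))) (subst \<sigma> G) (subst \<sigma> K) =
      Lam (sacol s t (lift (subst \<sigma> G)) (lift (subst \<sigma> K)))"
    by (simp only: sccol_SAbs scsubst.simps ssubst.simps t_def)
  ultimately show ?case
    using betas_scol_sacol [of t "lift (subst \<sigma> G)" "lift (subst \<sigma> K)"]
    by (simp only: betas_LamI rtranclp_trans)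
next
  case (Abs_Lam t)
  show ?case
    using Abs_Lam.IH [OF translates_subst_up [OF Abs_Lam.prems], of "lift G" "lift K"]
    by (simp add: ren_subst betas_LamI)
next
  case (semi_Abs t v)
  show ?case
    by (simp, intro betas_App semi_Abs.IH [OF semi_Abs.prems, simplified])
next
  case (semi_Cons t u l)
  have "subst \<sigma> (ssemi s t (SCons u l) G K) \<rightarrow>\<^sup>*
      scol s (ssubst \<tau> t) (subst \<sigma> G) (mpair (subst \<sigma> (sccol s l G K)) (subst \<sigma> (sbar s u)))"
    using semi_Cons.IH(3) [OF semi_Cons.prems, of G "mpair (sccol s l G K) (sbar s u)"] by simp
  also have "\<dots> \<rightarrow>\<^sup>* ssemi s (ssubst \<tau> t) (scsubst \<tau> (SCons u l)) (subst \<sigma> G) (subst \<sigma> K)"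
    by (simp, intro betas_scol betas_mpair rtranclp.rtrancl_refl semi_Cons.IH(1,2) [OF semi_Cons.prems])
  finally show ?case .
qed

lemma betas_subst_sacol:
  assumes "translates_subst \<sigma> \<tau>"
  shows "subst \<sigma> (sacol s t G K) \<rightarrow>\<^sup>* sacol s (ssubst \<tau> t) (subst \<sigma> G) (subst \<sigma> K)"
proof (cases t)
  case (SVar x)
  have "subst \<sigma> (scol s t G K) \<rightarrow>\<^sup>* scol s (ssubst \<tau> t) (subst \<sigma> G) (subst \<sigma> K)"
    using assms by (rule betas_subst_translation)
  also have "\<dots> \<rightarrow>\<^sup>* sacol s (ssubst \<tau> t) (subst \<sigma> G) (subst \<sigma> K)"
    by (rule betas_scol_sacol)
  finally show ?thesis by (simp add: SVar)
next
  case (SLam t')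
  then show ?thesis using betas_subst_translation(2) [OF assms, of t] by simp
next
  case (SApp t' l)
  then show ?thesis using betas_subst_translation(4) [OF assms] by simp
qed

section \<open>Simulation of the single rules and of their closure under constructors\<close>

lemma betap_sigma: "App (sccol s (SAbs v) G K) (sbar s t) \<rightarrow>\<^sup>+ sacol s (sinst t v) G K"
proof -
  have "translates_subst (case_nat (sbar s t) Var) (case_nat t SVar)"
    by (auto simp: translates_subst_def split: nat.split)
  from betas_subst_sacol [OF this, of v "lift G" "lift K"]
  have "inst (sbar s t) (sacol s v (lift G) (lift K)) \<rightarrow>\<^sup>* sacol s (sinst t v) G K"
    by (simp add: inst_def sinst_def)
  with beta.beta show ?thesis
    unfolding sccol_SAbs by (rule rtranclp_into_tranclp2)
qed

text \<open>For \<open>SAbs\<close> both sides coincide by definition; for \<open>SCons\<close> the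
  pair is unpacked and the barred term receives its arguments. This absorbs changes in the shape of
  a co-term.\<close>

lemma betas_sccol_sbar: "App (sccol s l G K) (sbar s t) \<rightarrow>\<^sup>* ssemi s t l G K"
proof (cases l)
  case (SCons u l')
  let ?K = "mpair (sccol s l' G K) (sbar s u)"
  have "App (sccol s l G K) (sbar s t) \<rightarrow>\<^sup>* App (App (sbar s t) G) ?K"
    using beta_mpair by (simp add: SCons r_into_rtranclp)
  also have "\<dots> \<rightarrow>\<^sup>* scol s t G ?K"
    by (intro tranclp_into_rtranclp betap_sbar_App)
  finally show ?thesis by (simp add: SCons)
qed simp

text \<open>If \<open>l\<close> is a cons, the only difference is the \<open>App s\<close>
  introduced by the variable. Otherwise contracting the inner redex replaces the bound variable by
  its own eta-expanded translation, which the substitution lemma reduces away.\<close>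

lemma betap_mu: "sccol s (SAbs (SApp (SVar 0) (sclift l))) G K \<rightarrow>\<^sup>+ sccol s l G K"
proof (cases l)
  case (SCons u l')
  have "App (App (Var 0) (App s (lift G))) K' \<rightarrow>\<^sup>+ App (App (Var 0) (lift G)) K'" for K'
    by (intro betap_AppL betap_AppR garbage)
  then have "Lam (App (App (Var 0) (App s (lift G))) (lift (mpair (sccol s l' G K) (sbar s u)))) \<rightarrow>\<^sup>+
      sccol s l G K"
    unfolding SCons sccol.simps mpair_def [of G] by (rule betap_LamI)
  then show ?thesis
    by (simp add: SCons ren_sbar ren_sccol)
next
  case (SAbs v)
  \<comment> \<open>The counterpart of the identity substitution \<open>SVar\<close> in which only
    the bound variable is replaced by its translation.\<close>
  let ?\<sigma> = "case_nat (sbar s (SVar 0)) (\<lambda>n. Var (Suc n))"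
  have tr: "translates_subst ?\<sigma> SVar"
    by (auto simp: translates_subst_def split: nat.split)
  have "sccol s (SAbs (SApp (SVar 0) (sclift l))) G K =
      Lam (App (lift (sccol s l G K)) (sbar s (SVar 0)))"
    by (simp add: SAbs ren_sccol)
  also have "\<dots> = Lam (App (Lam (ren (up_ren Suc) (sacol s v (lift G) (lift K)))) (sbar s (SVar 0)))"
    by (simp add: SAbs sccol_SAbs)
  also have "beta \<dots> (Lam (inst (sbar s (SVar 0)) (ren (up_ren Suc) (sacol s v (lift G) (lift K)))))"
    by (intro beta.intros)
  also have "inst (sbar s (SVar 0)) (ren (up_ren Suc) (sacol s v (lift G) (lift K))) =
      subst ?\<sigma> (sacol s v (lift G) (lift K))"
    by (simp add: inst_def case_nat_up_ren)
  finally have 1: "beta (sccol s (SAbs (SApp (SVar 0) (sclift l))) G K)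
      (Lam (subst ?\<sigma> (sacol s v (lift G) (lift K))))" .
  have "subst ?\<sigma> (sacol s v (lift G) (lift K)) \<rightarrow>\<^sup>* sacol s v (lift G) (lift K)"
    using betas_subst_sacol [OF tr, of v "lift G" "lift K"]
    by (simp add: ren_conv_subst [symmetric])
  then have "Lam (subst ?\<sigma> (sacol s v (lift G) (lift K))) \<rightarrow>\<^sup>* sccol s l G K"
    by (simp add: SAbs sccol_SAbs betas_LamI)
  with 1 show ?thesis by (rule rtranclp_into_tranclp2)
qed

text \<open>After the outer garbage is dropped (a copy survives inside \<open>?L\<close>), the pair
  hands \<open>?L\<close> to \<open>wabs\<close>, which moves it under the binder of
  \<open>x\<close> while \<open>?u\<close> stays pending. This matches the delayed substitution in
  the rule.\<close>

lemma betap_beta: "ssemi s (SLam t) (SCons u l) G K \<rightarrow>\<^sup>+ ssemi s u (SAbs (SApp t (sclift l))) G K"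
proof -
  let ?L = "sccol s l G K" and ?u = "sbar s u"
  have "ssemi s (SLam t) (SCons u l) G K \<rightarrow>\<^sup>+ App (mpair ?L ?u) (wabs (sbar s t))"
    by (simp add: beta_brk tranclp.r_into_trancl)
  also have "\<dots> \<rightarrow>\<^sup>+ App (App (wabs (sbar s t)) ?L) ?u"
    by (intro tranclp.r_into_trancl beta_mpair)
  also have "\<dots> \<rightarrow>\<^sup>+ App (Lam (App (lift ?L) (sbar s t))) ?u"
    by (intro tranclp.r_into_trancl beta.AppL beta_wabs)
  also have "\<dots> \<rightarrow>\<^sup>* ssemi s u (SAbs (SApp t (sclift l))) G K"
    using betas_sccol_sbar [of "sclift l" "lift G" "lift K" t]
    by (simp add: ren_sccol betas_LamI betas_App)
  finally show ?thesis .
qed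

text \<open>Appending a cons just extends the continuation, so it is invisible up to equality. The
  \<open>ssemi\<close> conjunct is needed because the clause for \<open>SAbs\<close> of an
  application passes through \<open>ssemi\<close>.\<close>

lemma translation_sappend:
  "sccol s (sappend l (SCons u l')) G K = sccol s l G (mpair (sccol s l' G K) (sbar s u)) \<and>
   (\<forall>t. ssemi s t (sappend l (SCons u l')) G K = ssemi s t l G (mpair (sccol s l' G K) (sbar s u)))"
  by (induction l "SCons u l'" arbitrary: u l' G K rule: sappend.induct)
    (simp_all add: ren_sbar ren_sccol)

text \<open>Passes from bodies back to \<open>scol\<close>. An abstraction reduces only to
  abstractions, where both notions agree. An application may become a value, so it is treated as a
  body with garbage \<open>App s G\<close>, and any surplus \<open>App s\<close> is removed at the
  end.\<close>

lemma betap_scol: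
  assumes "sred t u" "\<And>\<rho> G K. sacol s (sren \<rho> t) G K \<rightarrow>\<^sup>+ sacol s (sren \<rho> u) G K"
  shows "scol s (sren \<rho> t) G K \<rightarrow>\<^sup>+ scol s (sren \<rho> u) G K"
proof (cases t)
  case (SVar x)
  with assms(1) show ?thesis by (auto elim: sred.cases)
next
  case (SLam t')
  with assms(1) obtain u' where "u = SLam u'" by (auto elim: sred.cases)
  with SLam assms(2) [of \<rho> G K] show ?thesis by simp
next
  case (SApp t' l)
  then have "scol s (sren \<rho> t) G K = sacol s (sren \<rho> t) (App s G) K" by simp
  also have "\<dots> \<rightarrow>\<^sup>+ sacol s (sren \<rho> u) (App s G) K" by (rule assms)
  also have "\<dots> \<rightarrow>\<^sup>* scol s (sren \<rho> u) G K" by (rule betas_sacol_scol)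
  finally show ?thesis .
qed

lemma betap_sbar:
  assumes "sred t u" "\<And>\<rho> G K. sacol s (sren \<rho> t) G K \<rightarrow>\<^sup>+ sacol s (sren \<rho> u) G K"
  shows "sbar s (sren \<rho> t) \<rightarrow>\<^sup>+ sbar s (sren \<rho> u)"
  unfolding sbar.simps sren_sren by (intro betap_LamI betap_scol assms)

text \<open>Handles a co-term that loses its abstraction, as in the rule \<open>mu\<close>,
  whereupon \<open>ssemi\<close> changes its clause.\<close>

lemma betap_ssemi_SAbs:
  assumes "sccol s (SAbs v) G K \<rightarrow>\<^sup>+ sccol s l G K"
  shows "ssemi s t (SAbs v) G K \<rightarrow>\<^sup>+ ssemi s t l G K"
proof -
  have "ssemi s t (SAbs v) G K \<rightarrow>\<^sup>+ App (sccol s l G K) (sbar s t)"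
    unfolding ssemi.simps using assms by (rule betap_AppL)
  also have "\<dots> \<rightarrow>\<^sup>* ssemi s t l G K" by (rule betas_sccol_sbar)
  finally show ?thesis .
qed

text \<open>The translation lifts its argument, so the induction hypotheses have to cover all renamings
  of the terms involved.\<close>

lemma simulation:
  shows "sred t u \<Longrightarrow> sacol s (sren \<rho> t) G K \<rightarrow>\<^sup>+ sacol s (sren \<rho> u) G K"
    and "scred l l' \<Longrightarrow> sccol s (scren \<rho> l) G K \<rightarrow>\<^sup>+ sccol s (scren \<rho> l') G K \<and>
      (\<forall>t. ssemi s t (scren \<rho> l) G K \<rightarrow>\<^sup>+ ssemi s t (scren \<rho> l') G K)"
proof (induction arbitrary: \<rho> G K and \<rho> G K rule: sred_scred.inducts)
  case (beta t u l)
  show ?case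
    using betap_beta [of "sren (up_ren \<rho>) t" "sren \<rho> u" "scren \<rho> l" G K] by simp
next
  case (sigma t v)
  show ?case
    using betap_sigma [of "sren (up_ren \<rho>) v" G K "sren \<rho> t"] by (simp add: sren_sinst)
next
  case (pi t l u l')
  show ?case
    \<comment> \<open>Both sides have the same continuation; the strict step comes from the
      additional \<open>App s\<close> produced by the nested application.\<close>
    using betap_translation_G(3) [OF garbage] by (simp add: scren_sappend translation_sappend)
next
  case (mu l)
  have "sccol s (scren \<rho> (SAbs (SApp (SVar 0) (sclift l)))) G K \<rightarrow>\<^sup>+ sccol s (scren \<rho> l) G K"
    using betap_mu [of "scren \<rho> l" G K] by simp
  then show ?case by (simp del: ssemi.simps sccol.simps add: betap_ssemi_SAbs)
next
  case (Lam t t')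
  show ?case
    using betap_sbar [OF Lam.hyps Lam.IH, of "up_ren \<rho>"] by (simp add: betap_cong)
next
  case (App1 t t' l)
  show ?case
  proof (cases l)
    case (SCons u l')
    then show ?thesis using betap_scol [OF App1.hyps App1.IH] by simp
  next
    case (SAbs v)
    then show ?thesis
      using betap_sbar [OF App1.hyps App1.IH] by (simp add: betap_AppR)
  qed
next
  case (App2 l l' t)
  \<comment> \<open>Exactly the \<open>ssemi\<close> conjunct of the induction hypothesis; the claim
    about \<open>sccol\<close> alone would not suffice, since \<open>ssemi\<close> inspects the
    shape of the co-term.\<close>
  then show ?case by simp
next
  case (Cons1 u u' l)
  have "mpair L (sbar s (sren \<rho> u)) \<rightarrow>\<^sup>+ mpair L (sbar s (sren \<rho> u'))" for L
    by (intro betap_mpairR betap_sbar [OF Cons1.hyps Cons1.IH])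
  then show ?case by (simp add: betap_mpairR betap_translation_K)
next
  case (Cons2 l l' u)
  have "mpair (sccol s (scren \<rho> l) G K) U \<rightarrow>\<^sup>+ mpair (sccol s (scren \<rho> l') G K) U" for U
    using Cons2.IH by (simp add: betap_mpairL)
  then show ?case by (simp add: betap_mpairR betap_translation_K)
next
  case (Abs v v')
  have "sccol s (scren \<rho> (SAbs v)) G K \<rightarrow>\<^sup>+ sccol s (scren \<rho> (SAbs v')) G K"
    unfolding scren.simps sccol_SAbs by (intro betap_LamI Abs.IH)
  then show ?case by (simp del: ssemi.simps sccol.simps add: betap_ssemi_SAbs)
qed

lemma sred_simulation: "sred t u \<Longrightarrow> sbar s t \<rightarrow>\<^sup>+ sbar s u"
  using betap_sbar [of t u "\<lambda>n. n"] simulation(1) by simp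

lemma sred_tranclp_simulation: "sred\<^sup>+\<^sup>+ t u \<Longrightarrow> sbar s t \<rightarrow>\<^sup>+ sbar s u"
  by (erule tranclp_trans_induct) (auto intro: sred_simulation tranclp_trans)

end


section \<open>Embedding \<open>\<lambda>J\<^sup>m\<close> into \<open>\<lambda>J\<^sup>m\<^sup>s\<close>\<close>

primrec ms :: "mtm \<Rightarrow> stm" and mcs :: "mco \<Rightarrow> sco" where
  "ms (MVar n) = SVar n"
| "ms (MLam t) = SLam (ms t)"
| "ms (MApp t u l) = SApp (ms t) (SCons (ms u) (mcs l))"
| "mcs (MCons u l) = SCons (ms u) (mcs l)"
| "mcs (MAbs v) = SAbs (ms v)"

lemma ms_mren: "ms (mren \<rho> t) = sren \<rho> (ms t)"
  and mcs_mcren: "mcs (mcren \<rho> l) = scren \<rho> (mcs l)"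
  by (induction t and l arbitrary: \<rho> and \<rho>) simp_all

lemma ms_case_nat_up:
  "(\<lambda>n. ms (case_nat (MVar 0) (\<lambda>n. mlift (\<sigma> n)) n)) = case_nat (SVar 0) (\<lambda>n. slift (ms (\<sigma> n)))"
  by (auto simp: fun_eq_iff ms_mren split: nat.split)

lemma ms_msubst: "ms (msubst \<sigma> t) = ssubst (\<lambda>n. ms (\<sigma> n)) (ms t)"
  and mcs_mcsubst: "mcs (mcsubst \<sigma> l) = scsubst (\<lambda>n. ms (\<sigma> n)) (mcs l)"
  by (induction t and l arbitrary: \<sigma> and \<sigma>) (simp_all add: ms_case_nat_up)

lemma ms_minst: "ms (minst u t) = sinst (ms u) (ms t)"
proof -
  have "(\<lambda>n. ms (case_nat u MVar n)) = case_nat (ms u) SVar"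
    by (auto simp: fun_eq_iff split: nat.split)
  then show ?thesis by (simp add: minst_def sinst_def ms_msubst)
qed

lemma mcs_mcappend: "mcs (mcappend l (u, l')) = sappend (mcs l) (SCons (ms u) (mcs l'))"
  by (induction l "(u, l')" arbitrary: u l' rule: mcappend.induct) (simp_all add: ms_mren mcs_mcren)

text \<open>The clauses for \<open>MApp\<close> are those for \<open>SApp\<close> with
  \<open>ssemi\<close> already unfolded at a cons, so both translations agree exactly.\<close>

lemma mbar_ms: "mbar s t1 = sbar s (ms t1)"
  and mcol_ms: "mcol s t G K = scol s (ms t) G K"
  and mccol_mcs: "mccol s l G K = sccol s (mcs l) G K"
  by (induction s t1 and s t G K and s l G K rule: mbar_mcol_mccol.induct)
    (simp_all add: sbar.simps ms_mren)

text \<open>The rule \<open>beta\<close> only delays the substitution of \<open>u\<close>. A first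
  \<open>sigma\<close> step performs it, leaving the lifted co-term unchanged, and a second one
  substitutes the result into \<open>v\<close>.\<close>

lemma sred_beta_Abs:
  "sred\<^sup>+\<^sup>+ (SApp (SLam t) (SCons u (SAbs v))) (sinst (sinst u t) v)"
proof -
  have "sred\<^sup>+\<^sup>+ (SApp (SLam t) (SCons u (SAbs v))) (SApp u (SAbs (SApp t (sclift (SAbs v)))))"
    by (intro tranclp.r_into_trancl sred_scred.beta)
  also have "sred \<dots> (sinst u (SApp t (sclift (SAbs v))))"
    by (rule sred_scred.sigma)
  also have "sinst u (SApp t (sclift (SAbs v))) = SApp (sinst u t) (SAbs v)"
    by (simp add: sinst_def case_nat_up_ren case_nat_SVar)
  also have "sred \<dots> (sinst (sinst u t) v)"
    by (rule sred_scred.sigma)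
  finally show ?thesis .
qed

lemma sred_beta_Cons: "sred\<^sup>+\<^sup>+ (SApp (SLam t) (SCons u (SCons v l))) (SApp (sinst u t) (SCons v l))"
proof -
  have "sred\<^sup>+\<^sup>+ (SApp (SLam t) (SCons u (SCons v l))) (SApp u (SAbs (SApp t (sclift (SCons v l)))))"
    by (intro tranclp.r_into_trancl sred_scred.beta)
  also have "sred \<dots> (sinst u (SApp t (sclift (SCons v l))))"
    by (rule sred_scred.sigma)
  also have "sinst u (SApp t (sclift (SCons v l))) = SApp (sinst u t) (SCons v l)"
    by (simp add: sinst_def)
  finally show ?thesis .
qed

lemma sred_ms: "mred t t' \<Longrightarrow> sred\<^sup>+\<^sup>+ (ms t) (ms t')"
  and scred_mcs: "mcred l l' \<Longrightarrow> scred\<^sup>+\<^sup>+ (mcs l) (mcs l')"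
proof (induction rule: mred_mcred.inducts)
  case (beta1 t u v)
  show ?case using sred_beta_Abs by (simp add: ms_minst)
next
  case (beta2 t u v l)
  show ?case using sred_beta_Cons by (simp add: ms_minst)
next
  case (pi t R S)
  obtain u l u' l' where "R = (u, l)" "S = (u', l')" by fastforce
  then show ?case
    \<comment> \<open>A pair is embedded as a cons, which is the shape that \<open>pi\<close>
      demands of its second co-term.\<close>
    using sred_scred.pi [of "ms t" "SCons (ms u) (mcs l)" "ms u'" "mcs l'"]
    by (simp add: mcs_mcappend tranclp.r_into_trancl)
next
  case (mu u l)
  show ?case
    using sred_scred.mu [of "SCons (ms u) (mcs l)"]
    by (simp add: ms_mren mcs_mcren tranclp.r_into_trancl)
next
  case (Lam t t')
  then show ?case
    by (simp, elim tranclp_map) (rule sred_scred.intros)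
next
  case (App1 t t' u l)
  show ?case
    unfolding ms.simps
    by (rule tranclp_map [where f = "\<lambda>t. SApp t _", OF App1.IH]) (rule sred_scred.intros)
next
  case (App2 u u' t l)
  show ?case
    unfolding ms.simps
    by (rule tranclp_map [where f = "\<lambda>u. SApp _ (SCons u _)", OF App2.IH])
      (intro sred_scred.App2 sred_scred.Cons1)
next
  case (App3 l l' t u)
  show ?case
    unfolding ms.simps
    by (rule tranclp_map [where f = "\<lambda>l. SApp _ (SCons _ l)", OF App3.IH])
      (intro sred_scred.App2 sred_scred.Cons2)
next
  case (Cons1 u u' l)
  show ?case
    unfolding mcs.simps
    by (rule tranclp_map [where f = "\<lambda>u. SCons u _", OF Cons1.IH]) (rule sred_scred.intros)
next
  case (Cons2 l l' u)
  show ?case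
    unfolding mcs.simps
    by (rule tranclp_map [where f = "SCons _", OF Cons2.IH]) (rule sred_scred.intros)
next
  case (Abs v v')
  show ?case
    unfolding mcs.simps
    by (rule tranclp_map [where f = SAbs, OF Abs.IH]) (rule sred_scred.intros)
qed


section \<open>Embedding \<open>\<lambda>J\<close> into \<open>\<lambda>J\<^sup>m\<close>\<close>

primrec jm :: "jtm \<Rightarrow> mtm" where
  "jm (JVar n) = MVar n"
| "jm (JLam t) = MLam (jm t)"
| "jm (JApp t u v) = MApp (jm t) (jm u) (MAbs (jm v))"

lemma jm_jren: "jm (jren \<rho> t) = mren \<rho> (jm t)"
  by (induction t arbitrary: \<rho>) simp_all

lemma jm_case_nat_up:
  "(\<lambda>n. jm (case_nat (JVar 0) (\<lambda>n. jlift (\<sigma> n)) n)) = case_nat (MVar 0) (\<lambda>n. mlift (jm (\<sigma> n)))"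
  by (auto simp: fun_eq_iff jm_jren split: nat.split)

lemma jm_jsubst: "jm (jsubst \<sigma> t) = msubst (\<lambda>n. jm (\<sigma> n)) (jm t)"
  by (induction t arbitrary: \<sigma>) (simp_all add: jm_case_nat_up)

lemma jm_jinst: "jm (jinst u t) = minst (jm u) (jm t)"
proof -
  have "(\<lambda>n. jm (case_nat u JVar n)) = case_nat (jm u) MVar"
    by (auto simp: fun_eq_iff split: nat.split)
  then show ?thesis by (simp add: jinst_def minst_def jm_jsubst)
qed

lemma japp_jm: "jm (japp t R) = mapp (jm t) (map_prod jm (\<lambda>v. MAbs (jm v)) R)"
  by (cases R) simp

lemma jappend_jm:
  "map_prod jm (\<lambda>v. MAbs (jm v)) (jappend R S) =
   mappend (map_prod jm (\<lambda>v. MAbs (jm v)) R) (map_prod jm (\<lambda>v. MAbs (jm v)) S)"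
proof (induction R S rule: jappend.induct)
  case (1 u t u' v S)
  from 1 show ?case by (cases S) (simp add: japp_jm jm_jren)
qed (auto simp: jm_jren)

lemma mred_jm: "jred t t' \<Longrightarrow> mred (jm t) (jm t')"
proof (induction rule: jred.induct)
  case (pi t R S)
  show ?case unfolding japp_jm jappend_jm by (rule mred_mcred.pi)
qed (auto simp: jm_jinst intro: mred_mcred.intros)

lemma jbar_jm: "closed s \<Longrightarrow> jbar s t1 = mbar s (jm t1)"
  and jcol_jm: "closed s \<Longrightarrow> jcol s t G K = mcol s (jm t) G K"
proof (induction s t1 and s t G K rule: jbar_jcol.induct)
  case (4 s t u v G K)
  \<comment> \<open>The value test of \<open>jcol\<close> is the clause split of
    \<open>mccol\<close> at \<open>MAbs\<close>. For an application, \<open>mcol\<close> adds the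
    missing \<open>App s\<close> itself, under the binder; closedness of \<open>s\<close> makes this
    equal to lifting \<open>App s G\<close>.\<close>
  have "Lam (mcol s (jm v) (lift (if jvalue v then App s G else G)) (lift K)) =
      mccol s (MAbs (jm v)) (App s G) K"
    by (cases v) (simp_all add: closed_ren [OF "4.prems"])
  with 4 show ?case by (simp del: jbar.simps mbar.simps)
qed (simp_all add: jm_jren)

theorem theorem4p8:
  fixes s :: lam
  assumes "closed s"
    and "\<And>G. beta\<^sup>+\<^sup>+ (App s G) G"
  shows "(\<forall>t u. sred t u \<longrightarrow> beta\<^sup>+\<^sup>+ (sbar s t) (sbar s u)) \<and>
         (\<forall>t u. mred t u \<longrightarrow> beta\<^sup>+\<^sup>+ (mbar s t) (mbar s u)) \<and>
         (\<forall>t u. jred t u \<longrightarrow> beta\<^sup>+\<^sup>+ (jbar s t) (jbar s u))"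
proof -
  interpret garbage_combinator s
    using assms by unfold_locales
  show ?thesis
    using sred_simulation sred_tranclp_simulation sred_ms mred_jm
    by (simp only: mbar_ms jbar_jm closed) blast
qed

end
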